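(* Let $\mathcal{O}$ be the set of overpartitions and let $\cdot$ be partition multiplication on $\mathcal{O}$. Then $(\mathcal{O},\cdot)$ is an Abelian group, with identity element the empty overpartition $\emptyset$.
   Context: An integer partition is a finite (possibly empty) weakly decreasing sequence of positive integers, called its parts. An overpartition is an integer partition in which, for each part size that occurs, the first occurrence of that part size may be either marked with an overline or left unmarked. $\mathcal{O}$ denotes the set of all overpartitions, including the empty overpartition $\emptyset$ (no parts). Part-multiplicity notation: an overpartition $\alpha\in\mathcal{O}$ is written $\alpha=\langle 1^{\mu_1}2^{\mu_2}3^{\mu_3}\cdots i^{\mu_i}\cdots\rangle$ with $\mu_i\in\mathbb{Z}$ for each $i\in\mathbb{Z}^+$, where $|\mu_i|$ is the number of times $i$ occurs as a part of $\alpha$ (overlined or not), and $\mu_i$ is negative if and only if part size $i$ has an overline in $\alpha$. Only finitely many $\mu_i$ are nonzero, and $\emptyset=\langle 1^0 2^0 3^0\cdots\rangle$. This identifies overpartitions with finitely supported integer sequences $(\mu_i)_{i\ge 1}$. Partition multiplication on $\mathcal{O}$: for $\alpha=\langle 1^{\mu_1}2^{\mu_2}3^{\mu_3}\cdots\rangle$ and $\beta=\langle 1^{\nu_1}2^{\nu_2}3^{\nu_3}\cdots\rangle$, the product is the overpartition $\alpha\cdot\beta=\langle 1^{\mu_1+\nu_1}2^{\mu_2+\nu_2}3^{\mu_3+\nu_3}\cdots i^{\mu_i+\nu_i}\cdots\rangle$, in which part size $i$ has an overline if and only if $\mu_i+\nu_i<0$. *)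

theory Defs
  imports "HOL-Algebra.Group" "HOL-Library.Multiset"
begin

text \<open>
  An overpartition is the list of its parts in weakly decreasing order, each paired with a flag
  telling whether that occurrence is overlined; only a first occurrence of a part size may be.
\<close>

definition overpartitions :: "(nat \<times> bool) list set" where
  "overpartitions = {xs.
     sorted_wrt (\<ge>) (map fst xs) \<and>
     (\<forall>x \<in> set xs. fst x > 0) \<and>
     (\<forall>j < length xs. snd (xs ! j) \<longrightarrow> (\<forall>i < j. fst (xs ! i) \<noteq> fst (xs ! j)))}"

definition empty_overpartition :: "(nat \<times> bool) list" where
  "empty_overpartition = []"

text \<open>
  The signed multiplicity \<open>\<mu>\<^sub>i\<close> of the part size \<open>i\<close>. Part sizes are positive,
  so index \<open>0\<close> always has the value \<open>0\<close>.
\<close>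

definition part_mult :: "(nat \<times> bool) list \<Rightarrow> nat \<Rightarrow> int" where
  "part_mult xs i =
     (if (i, True) \<in> set xs then - int (count_list (map fst xs) i)
      else int (count_list (map fst xs) i))"

text \<open>
  The overpartition \<open>\<langle>1\<^bsup>\<mu>\<^sub>1\<^esup> 2\<^bsup>\<mu>\<^sub>2\<^esup> \<dots>\<rangle>\<close>; meaningful for finitely supported \<open>\<mu>\<close> with
  \<open>\<mu> 0 = 0\<close>, by \<open>bij_betw_part_mult\<close> below.
\<close>

definition of_part_mult :: "(nat \<Rightarrow> int) \<Rightarrow> (nat \<times> bool) list" where
  "of_part_mult \<mu> = (THE xs. xs \<in> overpartitions \<and> part_mult xs = \<mu>)"

definition partition_mult ::
    "(nat \<times> bool) list \<Rightarrow> (nat \<times> bool) list \<Rightarrow> (nat \<times> bool) list" where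
  "partition_mult \<alpha> \<beta> = of_part_mult (\<lambda>i. part_mult \<alpha> i + part_mult \<beta> i)"

lemma overpartition_flag_iff:
  assumes "xs \<in> overpartitions" "j < length xs"
  shows "snd (xs ! j) \<longleftrightarrow>
    part_mult xs (fst (xs ! j)) < 0 \<and> (\<forall>i < j. fst (xs ! i) \<noteq> fst (xs ! j))"
proof -
  let ?a = "fst (xs ! j)"
  have first: "\<And>k. k < length xs \<Longrightarrow> snd (xs ! k) \<Longrightarrow> \<forall>i < k. fst (xs ! i) \<noteq> fst (xs ! k)"
    using assms(1) by (auto simp: overpartitions_def)
  have "?a \<in> set (map fst xs)"
    using assms(2) by simp
  then have "count_list (map fst xs) ?a > 0"
    by (metis count_list_0_iff gr0I)
  then have neg: "part_mult xs ?a < 0 \<longleftrightarrow> (?a, True) \<in> set xs"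
    by (auto simp: part_mult_def)
  show ?thesis
  proof
    assume s: "snd (xs ! j)"
    then have "(?a, True) = xs ! j"
      by (simp add: prod_eq_iff)
    then have "(?a, True) \<in> set xs"
      using assms(2) by simp
    then show "part_mult xs ?a < 0 \<and> (\<forall>i < j. fst (xs ! i) \<noteq> ?a)"
      using neg first[OF assms(2) s] by blast
  next
    assume r: "part_mult xs ?a < 0 \<and> (\<forall>i < j. fst (xs ! i) \<noteq> ?a)"
    then obtain k where k: "k < length xs" "xs ! k = (?a, True)"
      using neg by (metis in_set_conv_nth)
    have "\<not> j < k"
      using first[OF k(1)] k(2) by auto
    moreover have "\<not> k < j"
      using r k(2) by auto
    ultimately show "snd (xs ! j)"
      using k(2) by (metis linorder_neqE_nat snd_conv)
  qed
qed

lemma abs_part_mult: "\<bar>part_mult xs i\<bar> = int (count_list (map fst xs) i)"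
  by (simp add: part_mult_def)

lemma inj_on_part_mult: "inj_on part_mult overpartitions"
proof (rule inj_onI)
  fix xs ys
  assume xs: "xs \<in> overpartitions" and ys: "ys \<in> overpartitions"
    and eq: "part_mult xs = part_mult ys"
  have "count_list (map fst xs) i = count_list (map fst ys) i" for i
    using abs_part_mult[of xs i] abs_part_mult[of ys i] eq by simp
  then have "mset (rev (map fst xs)) = mset (rev (map fst ys))"
    by (simp add: multiset_eq_iff count_mset del: mset_map)
  moreover have "sorted (rev (map fst xs))" "sorted (rev (map fst ys))"
    using xs ys by (auto simp: overpartitions_def sorted_wrt_rev)
  ultimately have "rev (map fst xs) = rev (map fst ys)"
    by (metis properties_for_sort)
  then have m: "map fst xs = map fst ys"
    by simp
  then have len: "length xs = length ys"
    by (metis length_map)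
  have f: "fst (xs ! j) = fst (ys ! j)" if "j < length xs" for j
    using m len that by (metis nth_map)
  show "xs = ys"
  proof (rule nth_equalityI[OF len])
    fix j assume j: "j < length xs"
    have "snd (xs ! j) = snd (ys ! j)"
      using overpartition_flag_iff[OF xs j] overpartition_flag_iff[OF ys, of j] j len f eq
      by simp
    then show "xs ! j = ys ! j"
      using f[OF j] by (simp add: prod_eq_iff)
  qed
qed

lemma ex_part_mult:
  assumes fin: "finite {i. \<mu> i \<noteq> (0::int)}" and zero: "\<mu> 0 = 0"
  shows "\<exists>xs \<in> overpartitions. part_mult xs = \<mu>"
proof -
  define M where "M = Abs_multiset (\<lambda>i. nat \<bar>\<mu> i\<bar>)"
  have "finite {i. 0 < nat \<bar>\<mu> i\<bar>}"
    using fin by (rule rev_finite_subset) auto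
  then have cM: "count M i = nat \<bar>\<mu> i\<bar>" for i
    by (simp add: M_def Abs_multiset_inverse)
  define l where "l = rev (sorted_list_of_multiset M)"
  have cl: "count_list l i = nat \<bar>\<mu> i\<bar>" for i
    using cM by (simp add: l_def flip: count_mset)
  have sl: "sorted_wrt (\<ge>) l"
    by (simp add: l_def sorted_wrt_rev)
  have setl: "i \<in> set l \<longleftrightarrow> \<mu> i \<noteq> 0" for i
    using cl[of i] by (metis count_list_0_iff nat_0_iff abs_le_zero_iff)
  define xs where
    "xs = map (\<lambda>j. (l ! j, \<mu> (l ! j) < 0 \<and> (\<forall>i<j. l ! i \<noteq> l ! j))) [0..<length l]"
  have mfst: "map fst xs = l"
    by (simp add: xs_def comp_def map_nth)
  have len: "length xs = length l"
    by (simp add: xs_def)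
  have nth: "xs ! j = (l ! j, \<mu> (l ! j) < 0 \<and> (\<forall>i<j. l ! i \<noteq> l ! j))" if "j < length l" for j
    using that by (simp add: xs_def)
  have pos: "fst x > 0" if "x \<in> set xs" for x
  proof -
    have "fst x \<in> set l"
      using that mfst by (metis image_eqI set_map)
    then show ?thesis
      using setl zero by (metis gr0I)
  qed
  have "xs \<in> overpartitions"
    using sl pos by (auto simp: overpartitions_def mfst len nth)
  moreover have "part_mult xs i = \<mu> i" for i
  proof -
    have "(i, True) \<in> set xs \<longleftrightarrow> \<mu> i < 0"
    proof
      assume "(i, True) \<in> set xs"
      then obtain j where "j < length l" "xs ! j = (i, True)"
        by (metis in_set_conv_nth len)
      then show "\<mu> i < 0"
        using nth by auto
    next
      assume neg: "\<mu> i < 0"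
      then have "\<exists>j. j < length l \<and> l ! j = i"
        using setl[of i] by (auto simp: in_set_conv_nth)
      then obtain j where j: "j < length l" "l ! j = i"
          and least: "\<And>k. k < j \<Longrightarrow> \<not> (k < length l \<and> l ! k = i)"
        using exists_least_iff[of "\<lambda>j. j < length l \<and> l ! j = i"] by blast
      have "xs ! j = (i, True)"
        using nth[OF j(1)] j least neg by auto
      then show "(i, True) \<in> set xs"
        using j(1) len by (metis nth_mem)
    qed
    then show ?thesis
      by (simp add: part_mult_def mfst cl)
  qed
  ultimately show ?thesis
    by auto
qed

lemma bij_betw_part_mult:
  "bij_betw part_mult overpartitions {\<mu>. finite {i. \<mu> i \<noteq> 0} \<and> \<mu> 0 = 0}"
proof -
  have "finite {i. part_mult xs i \<noteq> 0}" for xs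
  proof (rule finite_subset)
    show "{i. part_mult xs i \<noteq> 0} \<subseteq> set (map fst xs)"
      using abs_part_mult[of xs] 
      by (metis (mono_tags, lifting) abs_eq_0 count_notin mem_Collect_eq of_nat_0 subsetI)
  qed simp
  moreover have "part_mult xs 0 = 0" if "xs \<in> overpartitions" for xs
  proof -
    have "0 \<notin> set (map fst xs)"
      using that by (force simp: overpartitions_def)
    then show ?thesis
      using abs_part_mult[of xs 0] by (simp add: count_notin)
  qed
  ultimately show ?thesis
    using inj_on_part_mult ex_part_mult by (fastforce simp: bij_betw_def)
qed

end

theory Submission imports Defs begin

text \<open>
  The signed multiplicities turn partition multiplication into pointwise addition of integer
  sequences. The sequences that occur are exactly the finitely supported ones vanishing at \<open>0\<close>
  (\<open>bij_betw_part_mult\<close>), and these form an Abelian group under pointwise addition. The group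
  structure is transported along this bijection: \<open>part_mult_partition_mult\<close> says that
  \<open>part_mult\<close> is a homomorphism, so its injectivity reduces every group law to the
  same law in the integers. The inverse of an overpartition comes from negating its signed
  multiplicities, that is, from toggling the overline on every part size that occurs.
\<close>

definition signed_mults :: "(nat \<Rightarrow> int) set" where
  "signed_mults = {\<mu>. finite {i. \<mu> i \<noteq> 0} \<and> \<mu> 0 = 0}"

lemma signed_mults_add:
  assumes "\<mu> \<in> signed_mults" "\<nu> \<in> signed_mults"
  shows "(\<lambda>i. \<mu> i + \<nu> i) \<in> signed_mults"
proof -
  have "{i. \<mu> i + \<nu> i \<noteq> 0} \<subseteq> {i. \<mu> i \<noteq> 0} \<union> {i. \<nu> i \<noteq> 0}"
    by auto
  then show ?thesis
    using assms by (auto simp: signed_mults_def intro: finite_subset)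
qed

lemma signed_mults_uminus: "\<mu> \<in> signed_mults \<Longrightarrow> (\<lambda>i. - \<mu> i) \<in> signed_mults"
  by (simp add: signed_mults_def)

lemma part_mult_in_signed_mults: "\<alpha> \<in> overpartitions \<Longrightarrow> part_mult \<alpha> \<in> signed_mults"
  using bij_betw_part_mult by (auto simp: bij_betw_def signed_mults_def)

lemma overpartition_eqI:
  assumes "\<alpha> \<in> overpartitions" "\<beta> \<in> overpartitions" "\<And>i. part_mult \<alpha> i = part_mult \<beta> i"
  shows "\<alpha> = \<beta>"
  using assms inj_onD[OF inj_on_part_mult] by blast

text \<open>
  The definite description in \<open>of_part_mult\<close> denotes here: surjectivity gives a preimage
  and injectivity makes it unique.
\<close>

lemma of_part_mult:
  assumes "\<mu> \<in> signed_mults"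
  shows of_part_mult_in_overpartitions: "of_part_mult \<mu> \<in> overpartitions"
    and part_mult_of_part_mult: "part_mult (of_part_mult \<mu>) = \<mu>"
proof -
  have "\<exists>!xs. xs \<in> overpartitions \<and> part_mult xs = \<mu>"
    using assms ex_part_mult[of \<mu>] inj_onD[OF inj_on_part_mult]
    by (auto simp: signed_mults_def)
  from theI'[OF this] show "of_part_mult \<mu> \<in> overpartitions" "part_mult (of_part_mult \<mu>) = \<mu>"
    by (auto simp: of_part_mult_def)
qed

lemma partition_mult_closed:
  "\<alpha> \<in> overpartitions \<Longrightarrow> \<beta> \<in> overpartitions \<Longrightarrow> partition_mult \<alpha> \<beta> \<in> overpartitions"
  unfolding partition_mult_def
  by (intro of_part_mult_in_overpartitions signed_mults_add part_mult_in_signed_mults)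

lemma part_mult_partition_mult:
  assumes "\<alpha> \<in> overpartitions" "\<beta> \<in> overpartitions"
  shows "part_mult (partition_mult \<alpha> \<beta>) i = part_mult \<alpha> i + part_mult \<beta> i"
  using part_mult_of_part_mult[OF signed_mults_add] assms
  by (simp add: partition_mult_def part_mult_in_signed_mults)

lemma empty_in_overpartitions: "empty_overpartition \<in> overpartitions"
  by (simp add: empty_overpartition_def overpartitions_def)

lemma part_mult_empty: "part_mult empty_overpartition i = 0"
  by (simp add: empty_overpartition_def part_mult_def)

lemma partition_mult_left_inverse:
  assumes "\<alpha> \<in> overpartitions"
  shows "\<exists>\<beta> \<in> overpartitions. partition_mult \<beta> \<alpha> = empty_overpartition"
proof -
  define \<beta> where "\<beta> = of_part_mult (\<lambda>i. - part_mult \<alpha> i)"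
  have neg: "(\<lambda>i. - part_mult \<alpha> i) \<in> signed_mults"
    using assms by (intro signed_mults_uminus part_mult_in_signed_mults)
  have \<beta>: "\<beta> \<in> overpartitions" "part_mult \<beta> i = - part_mult \<alpha> i" for i
    using of_part_mult[OF neg] by (simp_all add: \<beta>_def)
  have "partition_mult \<beta> \<alpha> = empty_overpartition"
    by (rule overpartition_eqI)
      (simp_all add: assms \<beta> partition_mult_closed part_mult_partition_mult
        empty_in_overpartitions part_mult_empty)
  with \<beta>(1) show ?thesis ..
qed

theorem theorem3:
  "comm_group \<lparr>carrier = overpartitions, monoid.mult = partition_mult, one = empty_overpartition\<rparr>"
  by (rule comm_groupI)
    (auto intro: overpartition_eqI
      simp: partition_mult_closed part_mult_partition_mult
        empty_in_overpartitions part_mult_empty partition_mult_left_inverse)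

end
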